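(* Let $G=A\rtimes K$ be non-abelian, with $A$ and $K$ finite abelian groups. Then for every integer $m\ge 2$, \[ c_m(G)=\sum_{\substack{B\le K,\ D\le B\\ m=|A:C_B|\,|K:D|}} \lambda(B)\,\mu_B(D). \] Equivalently, if $m_{B,D}:=|A:C_B|\,|K:D|$, then \[ \mathcal P_G(z)=\sum_{B\le K}\sum_{D\le B} \frac{\lambda(B)\,\mu_B(D)}{m_{B,D}(m_{B,D}-z)}. \]
   Context: $A$ is the normal factor of $A\rtimes K$ and $\pi:G\to K$ is the natural projection. For $B\le K$, $C_B:=\mathrm{C}_A(B)$ is the subgroup of elements of $A$ fixed by every element of $B$ under the action of $K$ on $A$; $\lambda(B)$ is the number of abelian subgroups $H\le G$ with $\pi(H)=B$ and $H\cap A=C_B$; and for $D\le B$, $\mu_B(D):=\mu(D,B)$ is the Möbius function of the subgroup lattice interval $[D,B]$. For a finite group $G$ and $r\ge1$, $P_r(G):=|\mathrm{Hom}(\mathbb Z^r,G)|/|G|^r$, where $\mathrm{Hom}(\mathbb Z^r,G)$ is the set of pairwise commuting $r$-tuples in $G^r$, and $\mathcal P_G(z):=\sum_{r\ge 2}P_r(G)z^{r-2}$. For non-abelian $G$ and $m\ge2$, $c_m(G):=-\sum_{A'}\mu_2(A',G)$, the sum over all abelian subgroups $A'\le G$ with $|G:A'|=m$, where $\mu_2$ is the Möbius function of the poset (under inclusion) consisting of all abelian subgroups of $G$ together with $G$ itself. One has $P_r(G)=\sum_{m\ge2}c_m(G)m^{-r}$ (a finite sum) for all $r\ge2$. *)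

theory Defs
  imports
    "HOL-Algebra.Coset"
    "HOL-Algebra.Bij"
    "HOL-Computational_Algebra.Formal_Power_Series"
begin

definition semidirect_product ::
  "('a, 'c) monoid_scheme \<Rightarrow> ('b, 'd) monoid_scheme \<Rightarrow> ('b \<Rightarrow> 'a \<Rightarrow> 'a) \<Rightarrow> ('a \<times> 'b) monoid"
  where "semidirect_product A K \<phi> =
    \<lparr>carrier = carrier A \<times> carrier K,
     monoid.mult = (\<lambda>(a, k) (b, l). (a \<otimes>\<^bsub>A\<^esub> \<phi> k b, k \<otimes>\<^bsub>K\<^esub> l)),
     one = (\<one>\<^bsub>A\<^esub>, \<one>\<^bsub>K\<^esub>)\<rparr>"

lemma group_semidirect_product:
  assumes "group A" and "group K" and "\<phi> \<in> hom K (AutoGroup A)"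
  shows "group (semidirect_product A K \<phi>)"
proof -
  interpret A: group A by fact
  interpret K: group K by fact
  interpret Aut: group "AutoGroup A" by (rule A.AutoGroup)
  have aut: "\<phi> k \<in> auto A" if "k \<in> carrier K" for k
    using hom_in_carrier[OF assms(3) that] by (simp add: AutoGroup_def)
  then have bij: "\<phi> k \<in> Bij (carrier A)" and hom: "\<phi> k \<in> hom A A"
    if "k \<in> carrier K" for k
    using that by (auto simp: auto_def)
  have closed: "\<phi> k a \<in> carrier A" if "k \<in> carrier K" "a \<in> carrier A" for k a
    using hom[OF that(1)] that(2) by (rule hom_in_carrier)
  have mult: "\<phi> (k \<otimes>\<^bsub>K\<^esub> l) a = \<phi> k (\<phi> l a)"
    if "k \<in> carrier K" "l \<in> carrier K" "a \<in> carrier A" for k l a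
    using hom_mult[OF assms(3) that(1,2)] that bij
    by (simp add: AutoGroup_def BijGroup_def compose_def)
  have one: "\<phi> \<one>\<^bsub>K\<^esub> a = a" if "a \<in> carrier A" for a
    using hom_one[OF assms(3) K.is_group Aut.is_group] that
    by (simp add: AutoGroup_def BijGroup_def)
  show ?thesis
  proof (rule groupI)
    fix x assume x: "x \<in> carrier (semidirect_product A K \<phi>)"
    obtain a k where x_eq: "x = (a, k)" and ak: "a \<in> carrier A" "k \<in> carrier K"
      using x by (auto simp: semidirect_product_def)
    let ?y = "(\<phi> (inv\<^bsub>K\<^esub> k) (inv\<^bsub>A\<^esub> a), inv\<^bsub>K\<^esub> k)"
    have "\<phi> (inv\<^bsub>K\<^esub> k) (inv\<^bsub>A\<^esub> a) \<otimes>\<^bsub>A\<^esub> \<phi> (inv\<^bsub>K\<^esub> k) a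
        = \<phi> (inv\<^bsub>K\<^esub> k) (inv\<^bsub>A\<^esub> a \<otimes>\<^bsub>A\<^esub> a)"
      using ak by (intro hom_mult[OF hom, symmetric]) auto
    also have "\<dots> = \<one>\<^bsub>A\<^esub>"
      using ak hom_one[OF hom[OF K.inv_closed[OF ak(2)]] assms(1,1)] by simp
    finally have "?y \<otimes>\<^bsub>semidirect_product A K \<phi>\<^esub> x = \<one>\<^bsub>semidirect_product A K \<phi>\<^esub>"
      using ak by (simp add: semidirect_product_def x_eq)
    moreover have "?y \<in> carrier (semidirect_product A K \<phi>)"
      using ak closed by (simp add: semidirect_product_def)
    ultimately show "\<exists>y\<in>carrier (semidirect_product A K \<phi>).
        y \<otimes>\<^bsub>semidirect_product A K \<phi>\<^esub> x = \<one>\<^bsub>semidirect_product A K \<phi>\<^esub>"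
      by blast
  qed (auto simp: semidirect_product_def closed mult one hom_mult[OF hom] A.m_assoc K.m_assoc)
qed

definition abelian_subgroup :: "'a set \<Rightarrow> ('a, 'b) monoid_scheme \<Rightarrow> bool"
  where "abelian_subgroup H G \<longleftrightarrow> subgroup H G \<and> comm_group (G\<lparr>carrier := H\<rparr>)"

definition subgroup_index :: "('a, 'b) monoid_scheme \<Rightarrow> 'a set \<Rightarrow> nat"
  where "subgroup_index G H = card (rcosets\<^bsub>G\<^esub> H)"

text \<open>The Moebius function of a family \<open>P\<close> of finite sets ordered by inclusion, at members
  \<open>X\<close> and \<open>Y\<close> of \<open>P\<close>. Only the members of \<open>P\<close> between \<open>X\<close> and \<open>Y\<close> enter, so it is also the
  Moebius function of the interval from \<open>X\<close> to \<open>Y\<close>.\<close>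

function moebius :: "'a set set \<Rightarrow> 'a set \<Rightarrow> 'a set \<Rightarrow> int"
  where "moebius P X Y =
    (if X = Y then 1
     else if X \<subset> Y \<and> finite Y then - (\<Sum>Z \<in> {Z \<in> P. X \<subseteq> Z \<and> Z \<subset> Y}. moebius P X Z)
     else 0)"
  by pat_completeness auto
termination
  by (relation "measure (\<lambda>(P, X, Y). card Y)") (auto simp: psubset_card_mono)

declare moebius.simps [simp del]

definition subgroup_moebius :: "('a, 'b) monoid_scheme \<Rightarrow> 'a set \<Rightarrow> 'a set \<Rightarrow> int"
  where "subgroup_moebius K D B = moebius {H. subgroup H K} D B"

definition abelian_moebius :: "('a, 'b) monoid_scheme \<Rightarrow> 'a set \<Rightarrow> 'a set \<Rightarrow> int"
  where "abelian_moebius G X Y = moebius (insert (carrier G) {H. abelian_subgroup H G}) X Y"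

definition c_coeff :: "nat \<Rightarrow> ('a, 'b) monoid_scheme \<Rightarrow> int"
  where "c_coeff m G =
    - (\<Sum>H \<in> {H. abelian_subgroup H G \<and> subgroup_index G H = m}. abelian_moebius G H (carrier G))"

definition commuting_tuples :: "nat \<Rightarrow> ('a, 'b) monoid_scheme \<Rightarrow> (nat \<Rightarrow> 'a) set"
  where "commuting_tuples r G =
    {x \<in> {..<r} \<rightarrow>\<^sub>E carrier G. \<forall>i<r. \<forall>j<r. x i \<otimes>\<^bsub>G\<^esub> x j = x j \<otimes>\<^bsub>G\<^esub> x i}"

definition commuting_prob :: "nat \<Rightarrow> ('a, 'b) monoid_scheme \<Rightarrow> real"
  where "commuting_prob r G = real (card (commuting_tuples r G)) / real (order G) ^ r"

definition commuting_series :: "('a, 'b) monoid_scheme \<Rightarrow> real fps"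
  where "commuting_series G = Abs_fps (\<lambda>n. commuting_prob (n + 2) G)"

definition fixed_subgroup ::
  "('a, 'c) monoid_scheme \<Rightarrow> ('b \<Rightarrow> 'a \<Rightarrow> 'a) \<Rightarrow> 'b set \<Rightarrow> 'a set"
  where "fixed_subgroup A \<phi> B = {a \<in> carrier A. \<forall>b\<in>B. \<phi> b a = a}"

text \<open>Inside the semidirect product, a subset \<open>X\<close> of the normal factor \<open>A\<close> is \<open>X \<times> {\<one>}\<close>, and the
  projection to \<open>K\<close> is \<open>snd\<close>.\<close>

definition lambda_count ::
  "('a, 'c) monoid_scheme \<Rightarrow> ('b, 'd) monoid_scheme \<Rightarrow> ('b \<Rightarrow> 'a \<Rightarrow> 'a) \<Rightarrow> 'b set \<Rightarrow> nat"
  where "lambda_count A K \<phi> B =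
    card {H. abelian_subgroup H (semidirect_product A K \<phi>) \<and> snd ` H = B \<and>
             H \<inter> (carrier A \<times> {\<one>\<^bsub>K\<^esub>}) = fixed_subgroup A \<phi> B \<times> {\<one>\<^bsub>K\<^esub>}}"

definition pair_index ::
  "('a, 'c) monoid_scheme \<Rightarrow> ('b, 'd) monoid_scheme \<Rightarrow> ('b \<Rightarrow> 'a \<Rightarrow> 'a) \<Rightarrow> 'b set \<Rightarrow> 'b set \<Rightarrow> nat"
  where "pair_index A K \<phi> B D =
    subgroup_index A (fixed_subgroup A \<phi> B) * subgroup_index K D"

end

theory Submission
  imports Defs "HOL-Algebra.Generated_Groups"
begin

text \<open>Call an abelian subgroup \<open>M\<close> of \<open>G\<close> full if \<open>M \<inter> A\<close> is as large as possible, namely \<open>C\<^sub>B\<close>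
  with \<open>B = \<pi>(M)\<close>. Every abelian subgroup \<open>X\<close> lies in exactly one full subgroup with the same
  projection, namely \<open>X C\<^bsub>\<pi>(X)\<^esub>\<close>. Hence, if \<open>(M, D)\<close> runs over the pairs of a full \<open>M\<close> and
  \<open>D \<le> \<pi>(M)\<close>, the weights \<open>\<mu>(D, \<pi>(M))\<close> of those pairs for which \<open>M \<inter> \<pi>\<^sup>-\<^sup>1(D)\<close> contains \<open>X\<close>
  add up to 1. This property alone shows that \<open>- \<mu>\<^sub>2(H, G)\<close> is the sum of the weights of
  the pairs with \<open>M \<inter> \<pi>\<^sup>-\<^sup>1(D) = H\<close>, and that the number of commuting \<open>r\<close>-tuples is the weighted
  sum of \<open>|M \<inter> \<pi>\<^sup>-\<^sup>1(D)|\<^sup>r\<close>. Since \<open>|G : M \<inter> \<pi>\<^sup>-\<^sup>1(D)| = |A : C\<^sub>B| |K : D|\<close>, collecting the pairs by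
  \<open>B = \<pi>(M)\<close> gives both formulas, with no comparison of coefficients.\<close>

section \<open>Moebius inversion over a finite family of sets\<close>

lemma moebius_sum_right:
  assumes "X \<in> P" "Y \<in> P" "X \<subseteq> Y" "finite Y"
  shows "(\<Sum>Z \<in> {Z \<in> P. X \<subseteq> Z \<and> Z \<subseteq> Y}. moebius P X Z) = (if X = Y then 1 else 0)"
proof (cases "X = Y")
  case True
  then have "{Z \<in> P. X \<subseteq> Z \<and> Z \<subseteq> Y} = {X}"
    using assms by auto
  then show ?thesis
    using True by (simp add: moebius.simps)
next
  case False
  have fin: "finite {Z \<in> P. X \<subseteq> Z \<and> Z \<subset> Y}"
    using assms(4) by (auto intro: finite_subset[of _ "Pow Y"])
  have "{Z \<in> P. X \<subseteq> Z \<and> Z \<subseteq> Y} = insert Y {Z \<in> P. X \<subseteq> Z \<and> Z \<subset> Y}"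
    using assms by auto
  then have "(\<Sum>Z \<in> {Z \<in> P. X \<subseteq> Z \<and> Z \<subseteq> Y}. moebius P X Z)
      = moebius P X Y + (\<Sum>Z \<in> {Z \<in> P. X \<subseteq> Z \<and> Z \<subset> Y}. moebius P X Z)"
    using fin by simp
  also have "moebius P X Y = - (\<Sum>Z \<in> {Z \<in> P. X \<subseteq> Z \<and> Z \<subset> Y}. moebius P X Z)"
    using False assms by (subst moebius.simps) auto
  finally show ?thesis
    using False by simp
qed

text \<open>The recursion for \<open>moebius\<close> runs over the upper argument, so the identity
  in the lower argument needs an induction. It is needed because the pairs \<open>(M, D)\<close>
  vary the lower end D of \<mu>(D, \<pi>(M)).\<close>

lemma moebius_sum_left:
  assumes "X \<in> P" "Y \<in> P" "X \<subseteq> Y" "finite Y"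
  shows "(\<Sum>Z \<in> {Z \<in> P. X \<subseteq> Z \<and> Z \<subseteq> Y}. moebius P Z Y) = (if X = Y then 1 else 0)"
  using assms(1,3)
proof (induction "card Y - card X" arbitrary: X rule: less_induct)
  case less
  define S where "S W = (\<Sum>Z \<in> {Z \<in> P. W \<subseteq> Z \<and> Z \<subseteq> Y}. moebius P Z Y)" for W
  define I where "I = {W \<in> P. X \<subseteq> W \<and> W \<subseteq> Y}"
  have finI: "finite I"
    unfolding I_def using assms(4) by (auto intro: finite_subset[of _ "Pow Y"])
  have XI: "X \<in> I"
    using less.prems by (auto simp: I_def)
  have S: "S W = (if W = Y then 1 else 0)" if "W \<in> I - {X}" for W
  proof -
    have "X \<subset> W" "W \<subseteq> Y" "W \<in> P"
      using that by (auto simp: I_def)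
    moreover from this have "card X < card W" "card W \<le> card Y"
      using assms(4) by (auto intro: psubset_card_mono card_mono finite_subset)
    ultimately show ?thesis
      unfolding S_def by (intro less.hyps) auto
  qed
  \<comment> \<open>Double counting of \<mu>(X, W) \<mu>(Z, Y) over all chains X \<subseteq> W
    \<subseteq> Z \<subseteq> Y. Summing over W first leaves only Z = X, by the identity for the
    upper argument.\<close>
  have "(\<Sum>W\<in>I. moebius P X W * S W)
      = (\<Sum>W\<in>I. \<Sum>Z | Z \<in> I \<and> W \<subseteq> Z. moebius P X W * moebius P Z Y)"
    unfolding S_def sum_distrib_left
    by (intro sum.cong) (auto simp: I_def)
  also have "\<dots> = (\<Sum>Z\<in>I. \<Sum>W | W \<in> I \<and> W \<subseteq> Z. moebius P X W * moebius P Z Y)"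
    by (rule sum.swap_restrict[OF finI finI])
  also have "\<dots> = (\<Sum>Z\<in>I. (if X = Z then 1 else 0) * moebius P Z Y)"
  proof (rule sum.cong[OF refl])
    fix Z assume Z: "Z \<in> I"
    have "{W \<in> I. W \<subseteq> Z} = {W \<in> P. X \<subseteq> W \<and> W \<subseteq> Z}"
      using Z by (auto simp: I_def)
    moreover have "(\<Sum>W \<in> {W \<in> P. X \<subseteq> W \<and> W \<subseteq> Z}. moebius P X W) = (if X = Z then 1 else 0)"
      using Z assms(4) less.prems(1)
      by (intro moebius_sum_right) (auto simp: I_def intro: finite_subset)
    ultimately show "(\<Sum>W | W \<in> I \<and> W \<subseteq> Z. moebius P X W * moebius P Z Y)
        = (if X = Z then 1 else 0) * moebius P Z Y"
      by (simp add: sum_distrib_right[symmetric])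
  qed
  also have "\<dots> = moebius P X Y"
    using finI XI by (simp add: if_distrib[of "\<lambda>x. x * _"] cong: if_cong)
  finally have eq: "(\<Sum>W\<in>I. moebius P X W * S W) = moebius P X Y" .
  \<comment> \<open>The same sum again, with the unknown \<open>S X\<close> split off and all other
    \<open>S W\<close> known by induction.\<close>
  have "(\<Sum>W\<in>I. moebius P X W * S W)
      = moebius P X X * S X + (\<Sum>W\<in>I - {X}. moebius P X W * S W)"
    by (rule sum.remove[OF finI XI])
  also have "(\<Sum>W\<in>I - {X}. moebius P X W * S W)
      = (\<Sum>W\<in>I - {X}. if W = Y then moebius P X W else 0)"
    using S by (intro sum.cong) auto
  \<comment> \<open>If X = Y, the only index with a nonzero value has been removed together with X,
    hence the default 0.\<close>
  also have "\<dots> = (if X = Y then 0 else moebius P X Y)"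
    using finI assms(2) less.prems(2) by (auto simp: I_def)
  also have "moebius P X X = 1"
    by (simp add: moebius.simps)
  finally have "S X = (if X = Y then 1 else 0)"
    using eq by (auto simp: moebius.simps split: if_splits)
  then show ?case
    unfolding S_def .
qed

text \<open>A weighted family covering every member of \<open>P\<close> with total weight 1 computes the Moebius
  numbers of the adjoined top element: both sides solve the same triangular system.\<close>

lemma moebius_top_eq_weight_sum:
  fixes w :: "'t \<Rightarrow> int"
  assumes "finite Y" "\<And>X. X \<in> P \<Longrightarrow> X \<subset> Y" "finite T" "\<And>t. t \<in> T \<Longrightarrow> f t \<in> P"
    and weight: "\<And>X. X \<in> P \<Longrightarrow> (\<Sum>t | t \<in> T \<and> X \<subseteq> f t. w t) = 1"
    and "X \<in> P"
  shows "- moebius (insert Y P) X Y = (\<Sum>t | t \<in> T \<and> f t = X. w t)"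
proof -
  let ?Q = "insert Y P"
  define I where "I = {Z \<in> P. X \<subseteq> Z}"
  define T' where "T' = {t \<in> T. X \<subseteq> f t}"
  have finI: "finite I"
    unfolding I_def using assms(1,2) by (auto intro: finite_subset[of _ "Pow Y"])
  have finT': "finite T'"
    unfolding T'_def using assms(3) by simp
  have "{Z \<in> ?Q. X \<subseteq> Z \<and> Z \<subset> Y} = I"
    using assms(2) by (auto simp: I_def)
  then have "- moebius ?Q X Y = (\<Sum>Z\<in>I. moebius ?Q X Z)"
    using assms(1) assms(2)[OF assms(6)] by (subst moebius.simps) auto
  \<comment> \<open>Each term is multiplied by 1, written as the total weight of the indices
    covering Z.\<close>
  also have "\<dots> = (\<Sum>Z\<in>I. \<Sum>t | t \<in> T' \<and> Z \<subseteq> f t. moebius ?Q X Z * w t)"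
  proof (rule sum.cong[OF refl])
    fix Z assume "Z \<in> I"
    then have "Z \<in> P" and "{t \<in> T'. Z \<subseteq> f t} = {t \<in> T. Z \<subseteq> f t}"
      by (auto simp: I_def T'_def)
    then show "moebius ?Q X Z = (\<Sum>t | t \<in> T' \<and> Z \<subseteq> f t. moebius ?Q X Z * w t)"
      using weight by (simp add: sum_distrib_left[symmetric])
  qed
  also have "\<dots> = (\<Sum>t\<in>T'. \<Sum>Z | Z \<in> I \<and> Z \<subseteq> f t. moebius ?Q X Z * w t)"
    by (rule sum.swap_restrict[OF finI finT'])
  also have "\<dots> = (\<Sum>t\<in>T'. if f t = X then w t else 0)"
  proof (rule sum.cong[OF refl])
    fix t assume t: "t \<in> T'"
    \<comment> \<open>\<open>f t\<close> is a proper subset of Y, so the adjoined top Y never enters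
      an interval below \<open>f t\<close>.\<close>
    have "{Z \<in> I. Z \<subseteq> f t} = {Z \<in> ?Q. X \<subseteq> Z \<and> Z \<subseteq> f t}"
      using t assms(2)[OF assms(4)] by (auto simp: I_def T'_def)
    moreover have "(\<Sum>Z \<in> {Z \<in> ?Q. X \<subseteq> Z \<and> Z \<subseteq> f t}. moebius ?Q X Z) = (if X = f t then 1 else 0)"
    proof (rule moebius_sum_right)
      show "finite (f t)"
        using t assms(1) assms(2)[OF assms(4)] by (auto simp: T'_def intro: finite_subset)
    qed (use t assms(4,6) in \<open>auto simp: T'_def\<close>)
    ultimately show "(\<Sum>Z | Z \<in> I \<and> Z \<subseteq> f t. moebius ?Q X Z * w t) = (if f t = X then w t else 0)"
      by (auto simp: sum_distrib_right[symmetric])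
  qed
  also have "\<dots> = (\<Sum>t | t \<in> T \<and> f t = X. w t)"
    using assms(3) by (intro sum.mono_neutral_cong_right) (auto simp: T'_def finT')
  finally show ?thesis .
qed

section \<open>Abelian subgroups and centralizers\<close>

lemma abelian_subgroup_iff:
  assumes "group G"
  shows "abelian_subgroup H G \<longleftrightarrow>
    subgroup H G \<and> (\<forall>x\<in>H. \<forall>y\<in>H. x \<otimes>\<^bsub>G\<^esub> y = y \<otimes>\<^bsub>G\<^esub> x)"
proof
  assume "abelian_subgroup H G"
  then show "subgroup H G \<and> (\<forall>x\<in>H. \<forall>y\<in>H. x \<otimes>\<^bsub>G\<^esub> y = y \<otimes>\<^bsub>G\<^esub> x)"
    using comm_groupE(4)[of "G\<lparr>carrier := H\<rparr>"] by (auto simp: abelian_subgroup_def)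
next
  assume "subgroup H G \<and> (\<forall>x\<in>H. \<forall>y\<in>H. x \<otimes>\<^bsub>G\<^esub> y = y \<otimes>\<^bsub>G\<^esub> x)"
  then show "abelian_subgroup H G"
    using group.subgroup_imp_group[OF assms]
    by (auto simp: abelian_subgroup_def intro: group.group_comm_groupI)
qed

context group
begin

lemma subgroup_centralizer:
  assumes "S \<subseteq> carrier G"
  shows "subgroup {x \<in> carrier G. \<forall>s\<in>S. x \<otimes> s = s \<otimes> x} G"
proof (rule subgroupI)
  show "{x \<in> carrier G. \<forall>s\<in>S. x \<otimes> s = s \<otimes> x} \<noteq> {}"
    using assms by (auto intro!: exI[of _ \<one>])
next
  fix x assume x: "x \<in> {x \<in> carrier G. \<forall>s\<in>S. x \<otimes> s = s \<otimes> x}"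
  have "inv x \<otimes> s = s \<otimes> inv x" if "s \<in> S" for s
  proof -
    have xs: "x \<in> carrier G" "s \<in> carrier G" "x \<otimes> s = s \<otimes> x"
      using x that assms by auto
    have "inv x \<otimes> s = inv x \<otimes> (s \<otimes> x) \<otimes> inv x"
      using xs(1,2) by (simp add: m_assoc)
    also have "\<dots> = s \<otimes> inv x"
      using xs(1,2) by (simp add: xs(3)[symmetric] m_assoc[symmetric])
    finally show ?thesis .
  qed
  then show "inv x \<in> {x \<in> carrier G. \<forall>s\<in>S. x \<otimes> s = s \<otimes> x}"
    using x by auto
next
  fix x y assume "x \<in> {x \<in> carrier G. \<forall>s\<in>S. x \<otimes> s = s \<otimes> x}"
    "y \<in> {x \<in> carrier G. \<forall>s\<in>S. x \<otimes> s = s \<otimes> x}"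
  then have xy: "x \<in> carrier G" "y \<in> carrier G"
    "\<And>s. s \<in> S \<Longrightarrow> x \<otimes> s = s \<otimes> x" "\<And>s. s \<in> S \<Longrightarrow> y \<otimes> s = s \<otimes> y"
    by auto
  have "x \<otimes> y \<otimes> s = s \<otimes> (x \<otimes> y)" if "s \<in> S" for s
  proof -
    have s: "s \<in> carrier G"
      using that assms by auto
    have "x \<otimes> y \<otimes> s = x \<otimes> (s \<otimes> y)"
      using xy(1,2) s by (simp add: m_assoc xy(4)[OF that])
    also have "\<dots> = s \<otimes> x \<otimes> y"
      using xy(1,2) s by (simp add: m_assoc[symmetric] xy(3)[OF that])
    finally show ?thesis
      using xy(1,2) s by (simp add: m_assoc)
  qed
  then show "x \<otimes> y \<in> {x \<in> carrier G. \<forall>s\<in>S. x \<otimes> s = s \<otimes> x}"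
    using xy by auto
qed auto

text \<open>Centralizers are subgroups, which is used twice: the centralizer of S contains S and
  hence the generated subgroup H; so S lies in the centralizer of H, which therefore contains H as
  well.\<close>

lemma abelian_subgroup_generate:
  assumes "S \<subseteq> carrier G" and "\<And>x y. x \<in> S \<Longrightarrow> y \<in> S \<Longrightarrow> x \<otimes> y = y \<otimes> x"
  shows "abelian_subgroup (generate G S) G"
proof -
  let ?H = "generate G S"
  have H: "subgroup ?H G"
    by (rule generate_is_subgroup[OF assms(1)])
  have "?H \<subseteq> {x \<in> carrier G. \<forall>s\<in>S. x \<otimes> s = s \<otimes> x}"
    using assms by (intro generate_subgroup_incl subgroup_centralizer) auto
  then have "S \<subseteq> {x \<in> carrier G. \<forall>s\<in>?H. x \<otimes> s = s \<otimes> x}"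
    using assms(1) by fastforce
  then have "?H \<subseteq> {x \<in> carrier G. \<forall>s\<in>?H. x \<otimes> s = s \<otimes> x}"
    using subgroup.subset[OF H] by (rule generate_subgroup_incl[OF _ subgroup_centralizer])
  then show ?thesis
    using H by (auto simp: abelian_subgroup_iff[OF is_group])
qed

end

section \<open>A geometric power series\<close>

lemma fps_geometric_nth:
  fixes m :: real
  assumes "m \<noteq> 0"
  shows "fps_nth (fps_const c / (fps_const m * (fps_const m - fps_X))) n = c / m ^ (n + 2)"
proof -
  \<comment> \<open>The expected expansion of 1/(m(m - z)); multiplying it by the denominator gives
    1, which identifies it as the inverse.\<close>
  define g where "g = Abs_fps (\<lambda>n. 1 / m ^ (n + 2))"
  have "fps_const m * (fps_const m - fps_X) * g = 1"
  proof (rule fps_ext)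
    fix n
    show "fps_nth (fps_const m * (fps_const m - fps_X) * g) n = fps_nth 1 n"
      using assms by (cases n) (simp_all add: g_def algebra_simps power2_eq_square)
  qed
  then have "inverse (fps_const m * (fps_const m - fps_X)) = g"
    by (rule fps_inverse_unique)
  moreover have "fps_const c / (fps_const m * (fps_const m - fps_X))
      = fps_const c * inverse (fps_const m * (fps_const m - fps_X))"
    using assms by (intro fps_divide_unit) simp
  ultimately show ?thesis
    by (simp add: g_def)
qed

section \<open>The semidirect product and its projection\<close>

locale abelian_semidirect = A: comm_group A + K: comm_group K
  for A :: "('a, 'c) monoid_scheme" and K :: "('b, 'd) monoid_scheme" +
  fixes \<phi> :: "'b \<Rightarrow> 'a \<Rightarrow> 'a"
  assumes finite_A: "finite (carrier A)" and finite_K: "finite (carrier K)"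
    and action: "\<phi> \<in> hom K (AutoGroup A)"
begin

abbreviation G where "G \<equiv> semidirect_product A K \<phi>"

sublocale G: group G
  by (rule group_semidirect_product[OF A.is_group K.is_group action])

lemma carrier_G: "carrier G = carrier A \<times> carrier K"
  by (simp add: semidirect_product_def)

lemma finite_G: "finite (carrier G)"
  by (simp add: carrier_G finite_A finite_K)

lemma mult_G: "(a, k) \<otimes>\<^bsub>G\<^esub> (b, l) = (a \<otimes>\<^bsub>A\<^esub> \<phi> k b, k \<otimes>\<^bsub>K\<^esub> l)"
  by (simp add: semidirect_product_def)

lemma one_G: "\<one>\<^bsub>G\<^esub> = (\<one>\<^bsub>A\<^esub>, \<one>\<^bsub>K\<^esub>)"
  by (simp add: semidirect_product_def)

lemma action_hom: "k \<in> carrier K \<Longrightarrow> \<phi> k \<in> hom A A"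
  using hom_in_carrier[OF action, of k] by (simp add: AutoGroup_def auto_def)

lemma action_closed: "k \<in> carrier K \<Longrightarrow> a \<in> carrier A \<Longrightarrow> \<phi> k a \<in> carrier A"
  using action_hom hom_in_carrier by metis

lemma action_one: "a \<in> carrier A \<Longrightarrow> \<phi> \<one>\<^bsub>K\<^esub> a = a"
  using hom_one[OF action K.is_group A.AutoGroup] by (simp add: AutoGroup_def BijGroup_def)

lemma subgroup_fixed:
  assumes "B \<subseteq> carrier K"
  shows "subgroup (fixed_subgroup A \<phi> B) A"
proof (rule A.subgroupI)
  have "\<phi> b \<one>\<^bsub>A\<^esub> = \<one>\<^bsub>A\<^esub>" if "b \<in> B" for b
    using hom_one[OF action_hom A.is_group A.is_group] that assms by auto
  then show "fixed_subgroup A \<phi> B \<noteq> {}"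
    by (auto simp: fixed_subgroup_def)
next
  fix a assume a: "a \<in> fixed_subgroup A \<phi> B"
  have "\<phi> b (inv\<^bsub>A\<^esub> a) = inv\<^bsub>A\<^esub> a" if "b \<in> B" for b
  proof -
    have b: "b \<in> carrier K"
      using that assms by auto
    interpret h: group_hom A A "\<phi> b"
      using action_hom[OF b] A.is_group by (simp add: group_hom_def group_hom_axioms_def)
    show ?thesis
      using a that by (simp add: fixed_subgroup_def)
  qed
  then show "inv\<^bsub>A\<^esub> a \<in> fixed_subgroup A \<phi> B"
    using a by (auto simp: fixed_subgroup_def)
next
  fix a b assume "a \<in> fixed_subgroup A \<phi> B" "b \<in> fixed_subgroup A \<phi> B"
  then show "a \<otimes>\<^bsub>A\<^esub> b \<in> fixed_subgroup A \<phi> B"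
    using assms hom_mult[OF action_hom] by (auto simp: fixed_subgroup_def)
qed (auto simp: fixed_subgroup_def)

sublocale proj: group_hom G K snd
  by unfold_locales (auto simp: hom_def carrier_G mult_G)

lemma subgroup_snd: "subgroup H G \<Longrightarrow> subgroup (snd ` H) K"
  by (rule proj.subgroup_img_is_subgroup)

text \<open>Serves for cutting down a full subgroup to the part over D and, with M the whole group,
  for bounding the projection of a generated subgroup.\<close>

lemma subgroup_preimage:
  assumes "subgroup M G" "subgroup D K"
  shows "subgroup {x \<in> M. snd x \<in> D} G"
proof (rule G.subgroupI)
  show "{x \<in> M. snd x \<in> D} \<subseteq> carrier G"
    using subgroup.subset[OF assms(1)] by auto
  show "{x \<in> M. snd x \<in> D} \<noteq> {}"
    using subgroup.one_closed[OF assms(1)] subgroup.one_closed[OF assms(2)]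
    by (auto simp: one_G)
next
  fix x assume x: "x \<in> {x \<in> M. snd x \<in> D}"
  then have "x \<in> carrier G"
    using subgroup.subset[OF assms(1)] by auto
  then show "inv\<^bsub>G\<^esub> x \<in> {x \<in> M. snd x \<in> D}"
    using x subgroup.m_inv_closed[OF assms(1)] subgroup.m_inv_closed[OF assms(2)]
    by simp
next
  fix x y assume xy: "x \<in> {x \<in> M. snd x \<in> D}" "y \<in> {x \<in> M. snd x \<in> D}"
  then have "x \<in> carrier G" "y \<in> carrier G"
    using subgroup.subset[OF assms(1)] by auto
  then show "x \<otimes>\<^bsub>G\<^esub> y \<in> {x \<in> M. snd x \<in> D}"
    using xy subgroup.m_closed[OF assms(1)] subgroup.m_closed[OF assms(2)] by simp
qed

text \<open>For x = (a, b) the two products have first components c a and a \<phi>(b)(c). As A is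
  commutative, a cancels.\<close>

lemma fixed_commutes:
  assumes "x \<in> carrier G" "c \<in> carrier A"
  shows "(c, \<one>\<^bsub>K\<^esub>) \<otimes>\<^bsub>G\<^esub> x = x \<otimes>\<^bsub>G\<^esub> (c, \<one>\<^bsub>K\<^esub>) \<longleftrightarrow> \<phi> (snd x) c = c"
proof -
  obtain a b where x: "x = (a, b)" and ab: "a \<in> carrier A" "b \<in> carrier K"
    using assms(1) by (auto simp: carrier_G)
  have "(c, \<one>\<^bsub>K\<^esub>) \<otimes>\<^bsub>G\<^esub> x = x \<otimes>\<^bsub>G\<^esub> (c, \<one>\<^bsub>K\<^esub>) \<longleftrightarrow> a \<otimes>\<^bsub>A\<^esub> c = a \<otimes>\<^bsub>A\<^esub> \<phi> b c"
    using ab assms(2) by (simp add: x mult_G action_one A.m_comm)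
  also have "\<dots> \<longleftrightarrow> \<phi> b c = c"
    using ab assms(2) action_closed[OF ab(2) assms(2)] by auto
  finally show ?thesis
    by (simp add: x)
qed

text \<open>Elements of H \<inter> A commute with all of H, so \<pi>(H) fixes them. This is the
  upper bound that full subgroups attain.\<close>

lemma abelian_inter_kernel:
  assumes "abelian_subgroup H G"
  shows "H \<inter> (carrier A \<times> {\<one>\<^bsub>K\<^esub>}) \<subseteq> fixed_subgroup A \<phi> (snd ` H) \<times> {\<one>\<^bsub>K\<^esub>}"
proof -
  have H: "H \<subseteq> carrier G" "\<And>x y. x \<in> H \<Longrightarrow> y \<in> H \<Longrightarrow> x \<otimes>\<^bsub>G\<^esub> y = y \<otimes>\<^bsub>G\<^esub> x"
    using assms subgroup.subset by (auto simp: abelian_subgroup_iff[OF G.is_group])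
  have "\<phi> (snd x) c = c" if "(c, \<one>\<^bsub>K\<^esub>) \<in> H" "c \<in> carrier A" "x \<in> H" for c x
    using H(1) that H(2)[OF that(1,3)] fixed_commutes by blast
  then show ?thesis
    by (force simp: fixed_subgroup_def)
qed

section \<open>Full subgroups\<close>

definition full_subgroups :: "('a \<times> 'b) set set"
  where "full_subgroups = {M. abelian_subgroup M G \<and>
    M \<inter> (carrier A \<times> {\<one>\<^bsub>K\<^esub>}) = fixed_subgroup A \<phi> (snd ` M) \<times> {\<one>\<^bsub>K\<^esub>}}"

lemma finite_full_subgroups: "finite full_subgroups"
proof (rule finite_subset)
  show "full_subgroups \<subseteq> Pow (carrier G)"
    using subgroup.subset by (force simp: full_subgroups_def abelian_subgroup_def)
qed (simp add: finite_G)

lemma finite_subgroups_K: "finite {D. subgroup D K}"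
  using subgroup.subset finite_K by (auto intro!: finite_subset[of _ "Pow (carrier K)"])

text \<open>Existence: X and the fixed subgroup of B = \<pi>(X) commute elementwise, so together
  they generate an abelian group, which still projects onto B. Uniqueness: an element of M differs
  from an element of X with the same projection by an element of M \<inter> A, and this intersection
  depends only on B.\<close>

lemma ex1_full_subgroup:
  assumes X: "abelian_subgroup X G"
  shows "\<exists>!M. M \<in> full_subgroups \<and> X \<subseteq> M \<and> snd ` M = snd ` X"
proof (rule ex_ex1I)
  define B where "B = snd ` X"
  define C where "C = fixed_subgroup A \<phi> B \<times> {\<one>\<^bsub>K\<^esub>}"
  define M where "M = generate G (X \<union> C)"
  have Xs: "subgroup X G" and Xc: "\<And>x y. x \<in> X \<Longrightarrow> y \<in> X \<Longrightarrow> x \<otimes>\<^bsub>G\<^esub> y = y \<otimes>\<^bsub>G\<^esub> x"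
    using X by (auto simp: abelian_subgroup_iff[OF G.is_group])
  have XG: "X \<subseteq> carrier G"
    by (rule subgroup.subset[OF Xs])
  have B: "subgroup B K"
    unfolding B_def by (rule subgroup_snd[OF Xs])
  have CG: "C \<subseteq> carrier G"
    by (auto simp: C_def carrier_G fixed_subgroup_def)
  have CX: "c \<otimes>\<^bsub>G\<^esub> x = x \<otimes>\<^bsub>G\<^esub> c" if "c \<in> C" "x \<in> X" for c x
    using that XG fixed_commutes[of x "fst c"]
    by (force simp: C_def fixed_subgroup_def B_def)
  have CC: "c \<otimes>\<^bsub>G\<^esub> d = d \<otimes>\<^bsub>G\<^esub> c" if "c \<in> C" "d \<in> C" for c d
    using that by (auto simp: C_def mult_G fixed_subgroup_def action_one A.m_comm)
  have M: "abelian_subgroup M G"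
    unfolding M_def
  proof (rule G.abelian_subgroup_generate)
    show "X \<union> C \<subseteq> carrier G"
      using XG CG by blast
    fix x y assume "x \<in> X \<union> C" "y \<in> X \<union> C"
    then show "x \<otimes>\<^bsub>G\<^esub> y = y \<otimes>\<^bsub>G\<^esub> x"
      by (blast intro: Xc CX CX[symmetric] CC)
  qed
  have XCM: "X \<subseteq> M" "C \<subseteq> M"
    by (auto simp: M_def intro: generate.incl)
  \<comment> \<open>The preimage of B is a subgroup containing all generators, so the projection
    does not grow.\<close>
  have "M \<subseteq> {x \<in> carrier G. snd x \<in> B}"
    unfolding M_def
  proof (rule G.generate_subgroup_incl)
    show "X \<union> C \<subseteq> {x \<in> carrier G. snd x \<in> B}"
      using XG CG subgroup.one_closed[OF B] unfolding B_def C_def by force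
  qed (intro subgroup_preimage G.subgroup_self B)
  then have sM: "snd ` M = B"
    using XCM(1) by (auto simp: B_def)
  \<comment> \<open>M contains all of C by construction, and being abelian it cannot meet A in
    more.\<close>
  moreover have "M \<inter> (carrier A \<times> {\<one>\<^bsub>K\<^esub>}) = fixed_subgroup A \<phi> (snd ` M) \<times> {\<one>\<^bsub>K\<^esub>}"
    using abelian_inter_kernel[OF M] XCM(2) unfolding sM C_def
    by (auto simp: fixed_subgroup_def)
  ultimately show "\<exists>M. M \<in> full_subgroups \<and> X \<subseteq> M \<and> snd ` M = snd ` X"
    using M XCM(1) by (intro exI[of _ M]) (simp add: full_subgroups_def B_def)
next
  have le: "M \<subseteq> N"
    if M: "M \<in> full_subgroups" "snd ` M = snd ` X"
      and N: "N \<in> full_subgroups" "X \<subseteq> N" "snd ` N = snd ` X" and XM: "X \<subseteq> M" for M N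
  proof
    fix x assume x: "x \<in> M"
    then obtain y where y: "y \<in> X" "snd y = snd x"
      using M(2) by (metis (no_types) imageE imageI)
    have Ms: "subgroup M G" and Ns: "subgroup N G"
      using M N by (auto simp: full_subgroups_def abelian_subgroup_def)
    have xy: "x \<in> carrier G" "y \<in> carrier G"
      using x y XM subgroup.subset[OF Ms] by auto
    let ?c = "x \<otimes>\<^bsub>G\<^esub> inv\<^bsub>G\<^esub> y"
    have c: "?c \<in> M"
      using x y(1) XM by (blast intro: subgroup.m_closed[OF Ms] subgroup.m_inv_closed[OF Ms])
    then have "?c \<in> carrier G"
      using subgroup.subset[OF Ms] by blast
    moreover have "snd y \<in> carrier K"
      using xy(2) by (auto simp: carrier_G)
    then have "snd ?c = \<one>\<^bsub>K\<^esub>"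
      using xy by (simp add: y(2)[symmetric])
    ultimately have "?c \<in> M \<inter> (carrier A \<times> {\<one>\<^bsub>K\<^esub>})"
      using c by (auto simp: carrier_G mem_Times_iff)
    \<comment> \<open>Both intersections are the fixed subgroup of the common projection
      \<pi>(X).\<close>
    moreover have "M \<inter> (carrier A \<times> {\<one>\<^bsub>K\<^esub>}) = N \<inter> (carrier A \<times> {\<one>\<^bsub>K\<^esub>})"
      using M N(1,3) by (simp add: full_subgroups_def)
    ultimately have "?c \<in> N \<inter> (carrier A \<times> {\<one>\<^bsub>K\<^esub>})"
      by (simp only:)
    then have "?c \<in> N"
      by (rule IntD1)
    then have "?c \<otimes>\<^bsub>G\<^esub> y \<in> N"
      using y(1) N(2) by (blast intro: subgroup.m_closed[OF Ns])
    then show "x \<in> N"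
      using xy by (simp add: G.m_assoc)
  qed
  fix M N
  assume "M \<in> full_subgroups \<and> X \<subseteq> M \<and> snd ` M = snd ` X"
    and "N \<in> full_subgroups \<and> X \<subseteq> N \<and> snd ` N = snd ` X"
  then show "M = N"
    using le[of M N] le[of N M] by blast
qed

section \<open>Weighted pairs\<close>

definition full_pairs :: "(('a \<times> 'b) set \<times> 'b set) set"
  where "full_pairs = Sigma full_subgroups (\<lambda>M. {D. subgroup D K \<and> D \<subseteq> snd ` M})"

text \<open>This is M \<inter> \<pi>\<inverse>(D). It meets A in the fixed subgroup of \<pi>(M),
  which can be smaller than that of D, and different pairs can give the same subgroup.\<close>

definition restrict_pair :: "('a \<times> 'b) set \<times> 'b set \<Rightarrow> ('a \<times> 'b) set"
  where "restrict_pair t = {x \<in> fst t. snd x \<in> snd t}"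

definition pair_weight :: "('a \<times> 'b) set \<times> 'b set \<Rightarrow> int"
  where "pair_weight t = subgroup_moebius K (snd t) (snd ` fst t)"

lemma finite_full_pairs: "finite full_pairs"
  unfolding full_pairs_def using finite_full_subgroups finite_subgroups_K by auto

lemma abelian_restrict_pair:
  assumes "t \<in> full_pairs"
  shows "abelian_subgroup (restrict_pair t) G"
  using assms subgroup_preimage[of "fst t" "snd t"]
  by (auto simp: full_pairs_def full_subgroups_def restrict_pair_def
      abelian_subgroup_iff[OF G.is_group])

text \<open>The pair covers X iff X \<subseteq> M and \<pi>(X) \<le> D. For fixed M the sum of
  \<mu>(D, \<pi>(M)) over such D vanishes unless \<pi>(X) = \<pi>(M), so what remains is the number
  of full M above X with the same projection, which is 1.\<close>

lemma sum_pair_weight: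
  assumes X: "abelian_subgroup X G"
  shows "(\<Sum>t | t \<in> full_pairs \<and> X \<subseteq> restrict_pair t. pair_weight t) = 1"
proof -
  let ?F = "{M \<in> full_subgroups. X \<subseteq> M}"
  let ?I = "\<lambda>M. {D \<in> {D. subgroup D K}. snd ` X \<subseteq> D \<and> D \<subseteq> snd ` M}"
  have Xs: "subgroup X G"
    using X by (simp add: abelian_subgroup_def)
  have "{t \<in> full_pairs. X \<subseteq> restrict_pair t} = Sigma ?F ?I"
    by (auto simp: full_pairs_def restrict_pair_def)
  then have "(\<Sum>t | t \<in> full_pairs \<and> X \<subseteq> restrict_pair t. pair_weight t)
      = (\<Sum>t \<in> Sigma ?F ?I. pair_weight t)"
    by simp
  also have "\<dots> = (\<Sum>M\<in>?F. \<Sum>D\<in>?I M. subgroup_moebius K D (snd ` M))"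
    using finite_full_subgroups finite_subgroups_K
    by (subst sum.Sigma) (auto simp: pair_weight_def split_def)
  also have "\<dots> = (\<Sum>M\<in>?F. if snd ` X = snd ` M then 1 else 0)"
  proof (rule sum.cong[OF refl])
    fix M assume M: "M \<in> ?F"
    then have "subgroup (snd ` M) K"
      using subgroup_snd by (auto simp: full_subgroups_def abelian_subgroup_def)
    moreover from this have "finite (snd ` M)"
      using subgroup.subset finite_K finite_subset by metis
    ultimately show "(\<Sum>D\<in>?I M. subgroup_moebius K D (snd ` M)) = (if snd ` X = snd ` M then 1 else 0)"
      unfolding subgroup_moebius_def
      using M subgroup_snd[OF Xs] by (intro moebius_sum_left) auto
  qed
  also have "\<dots> = int (card {M \<in> full_subgroups. X \<subseteq> M \<and> snd ` M = snd ` X})"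
    using finite_full_subgroups
    by (subst sum.inter_filter[symmetric]) (auto intro!: arg_cong[of _ _ card])
  also have "\<dots> = 1"
  proof -
    obtain M where M: "M \<in> full_subgroups \<and> X \<subseteq> M \<and> snd ` M = snd ` X"
      and uniq: "\<forall>N. N \<in> full_subgroups \<and> X \<subseteq> N \<and> snd ` N = snd ` X \<longrightarrow> N = M"
      using ex1_full_subgroup[OF X] by (rule ex1E)
    have "N \<in> {M \<in> full_subgroups. X \<subseteq> M \<and> snd ` M = snd ` X} \<longleftrightarrow> N \<in> {M}" for N
      using M spec[OF uniq, of N] by auto
    then have "{M \<in> full_subgroups. X \<subseteq> M \<and> snd ` M = snd ` X} = {M}"
      by (simp add: set_eq_iff)
    then show ?thesis
      by simp
  qed
  finally show ?thesis .
qed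

text \<open>With a set-theoretic section s of the projection over D, taking values in M, every
  element is uniquely a product of a fixed element of A and some \<open>s d\<close>.\<close>

lemma card_restrict_pair:
  assumes "(M, D) \<in> full_pairs"
  shows "card (restrict_pair (M, D)) = card (fixed_subgroup A \<phi> (snd ` M)) * card D"
proof -
  let ?C = "fixed_subgroup A \<phi> (snd ` M)"
  have M: "subgroup M G" "M \<inter> (carrier A \<times> {\<one>\<^bsub>K\<^esub>}) = ?C \<times> {\<one>\<^bsub>K\<^esub>}"
    and D: "subgroup D K" "D \<subseteq> snd ` M"
    using assms by (auto simp: full_pairs_def full_subgroups_def abelian_subgroup_def)
  have MG: "M \<subseteq> carrier G"
    by (rule subgroup.subset[OF M(1)])
  have "\<forall>d\<in>D. \<exists>x\<in>M. snd x = d"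
    using D(2) by blast
  then obtain s where s: "\<And>d. d \<in> D \<Longrightarrow> s d \<in> M" "\<And>d. d \<in> D \<Longrightarrow> snd (s d) = d"
    by metis
  have sG: "s d \<in> carrier G" if "d \<in> D" for d
    using s(1)[OF that] MG by auto
  have cG: "(c, \<one>\<^bsub>K\<^esub>) \<in> carrier G" "(c, \<one>\<^bsub>K\<^esub>) \<in> M" if "c \<in> ?C" for c
    using that M(2) MG by auto
  let ?f = "\<lambda>(c, d). (c, \<one>\<^bsub>K\<^esub>) \<otimes>\<^bsub>G\<^esub> s d"
  have snd_f: "snd ((c, \<one>\<^bsub>K\<^esub>) \<otimes>\<^bsub>G\<^esub> s d) = d" if "c \<in> ?C" "d \<in> D" for c d
    using cG(1)[OF that(1)] sG[OF that(2)] s(2)[OF that(2)] subgroup.mem_carrier[OF D(1) that(2)]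
    by simp
  have "bij_betw ?f (?C \<times> D) (restrict_pair (M, D))"
    unfolding bij_betw_def
  proof
    show "inj_on ?f (?C \<times> D)"
    proof (rule inj_onI, clarify)
      fix c d c' d'
      assume *: "c \<in> ?C" "d \<in> D" "c' \<in> ?C" "d' \<in> D"
        "(c, \<one>\<^bsub>K\<^esub>) \<otimes>\<^bsub>G\<^esub> s d = (c', \<one>\<^bsub>K\<^esub>) \<otimes>\<^bsub>G\<^esub> s d'"
      then have "d = d'"
        using snd_f by metis
      moreover from this have "(c, \<one>\<^bsub>K\<^esub>) = (c', \<one>\<^bsub>K\<^esub>)"
        using * cG sG G.right_cancel by blast
      ultimately show "c = c' \<and> d = d'"
        by simp
    qed
    show "?f ` (?C \<times> D) = restrict_pair (M, D)"
    proof
      show "?f ` (?C \<times> D) \<subseteq> restrict_pair (M, D)"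
        using snd_f subgroup.m_closed[OF M(1) cG(2) s(1)] by (auto simp: restrict_pair_def)
    next
      show "restrict_pair (M, D) \<subseteq> ?f ` (?C \<times> D)"
      proof
        fix x assume "x \<in> restrict_pair (M, D)"
        then have x: "x \<in> M" "snd x \<in> D"
          by (auto simp: restrict_pair_def)
        let ?d = "snd x"
        let ?c = "x \<otimes>\<^bsub>G\<^esub> inv\<^bsub>G\<^esub> (s ?d)"
        have xG: "x \<in> carrier G"
          using x MG by auto
        have "snd ?c = \<one>\<^bsub>K\<^esub>"
          using xG sG[OF x(2)] s(2)[OF x(2)] subgroup.mem_carrier[OF D(1) x(2)] by simp
        moreover have "?c \<in> M"
          using x s(1)[OF x(2)] subgroup.m_closed[OF M(1)] subgroup.m_inv_closed[OF M(1)] by auto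
        ultimately have "?c \<in> M \<inter> (carrier A \<times> {\<one>\<^bsub>K\<^esub>})"
          using MG by (cases ?c) (auto simp: carrier_G)
        then have c: "?c \<in> ?C \<times> {\<one>\<^bsub>K\<^esub>}"
          using M(2) by simp
        then have "(fst ?c, \<one>\<^bsub>K\<^esub>) = ?c"
          by (cases ?c) auto
        then have "x = ?f (fst ?c, ?d)"
          using xG sG[OF x(2)] by (simp add: G.m_assoc)
        moreover have "(fst ?c, ?d) \<in> ?C \<times> D"
          using c x(2) by (cases ?c) auto
        ultimately show "x \<in> ?f ` (?C \<times> D)"
          by (rule image_eqI)
      qed
    qed
  qed
  then show ?thesis
    by (metis bij_betw_same_card card_cartesian_product)
qed

text \<open>Lagrange's theorem in G, A and K; the order of the subgroup is then cancelled.\<close>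

lemma index_restrict_pair:
  assumes "(M, D) \<in> full_pairs"
  shows "subgroup_index G (restrict_pair (M, D)) = pair_index A K \<phi> (snd ` M) D"
proof -
  let ?C = "fixed_subgroup A \<phi> (snd ` M)"
  let ?R = "restrict_pair (M, D)"
  have D: "subgroup D K" and M: "subgroup M G"
    using assms by (auto simp: full_pairs_def full_subgroups_def abelian_subgroup_def)
  have R: "subgroup ?R G"
    using abelian_restrict_pair[OF assms] by (simp add: abelian_subgroup_def)
  have C: "subgroup ?C A"
    using subgroup.subset[OF subgroup_snd[OF M]] by (rule subgroup_fixed)
  have "subgroup_index G ?R * card ?R = card (carrier A) * card (carrier K)"
    using G.lagrange[OF R] by (simp add: subgroup_index_def order_def carrier_G card_cartesian_product)
  also have "\<dots> = (subgroup_index A ?C * card ?C) * (subgroup_index K D * card D)"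
    using A.lagrange[OF C] K.lagrange[OF D] by (simp add: subgroup_index_def order_def)
  also have "\<dots> = pair_index A K \<phi> (snd ` M) D * card ?R"
    by (simp add: card_restrict_pair[OF assms] pair_index_def)
  finally show ?thesis
    using subgroup.finite_imp_card_positive[OF R finite_G] by simp
qed

text \<open>Weight and index depend on M only through B = \<pi>(M), and \<open>lambda_count\<close>
  counts the full M over B. The function g and its ring are left open, since an integer indicator is
  needed for the coefficients and a real power for the series.\<close>

lemma sum_full_pairs:
  fixes g :: "nat \<Rightarrow> 'r :: comm_ring_1"
  shows "(\<Sum>t\<in>full_pairs. of_int (pair_weight t) * g (subgroup_index G (restrict_pair t))) =
    (\<Sum>B \<in> {B. subgroup B K}. \<Sum>D \<in> {D. subgroup D K \<and> D \<subseteq> B}.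
      of_int (int (lambda_count A K \<phi> B) * subgroup_moebius K D B) * g (pair_index A K \<phi> B D))"
proof -
  define h where "h B = (\<Sum>D \<in> {D. subgroup D K \<and> D \<subseteq> B}.
    of_int (subgroup_moebius K D B) * g (pair_index A K \<phi> B D))" for B
  have "(\<Sum>t\<in>full_pairs. of_int (pair_weight t) * g (subgroup_index G (restrict_pair t)))
      = (\<Sum>(M, D)\<in>full_pairs. of_int (subgroup_moebius K D (snd ` M)) * g (pair_index A K \<phi> (snd ` M) D))"
    by (rule sum.cong) (auto simp: pair_weight_def index_restrict_pair)
  also have "\<dots> = (\<Sum>M\<in>full_subgroups. h (snd ` M))"
    unfolding full_pairs_def h_def using finite_full_subgroups finite_subgroups_K
    by (subst sum.Sigma) auto
  also have "\<dots> = (\<Sum>B | subgroup B K. \<Sum>M | M \<in> full_subgroups \<and> snd ` M = B. h (snd ` M))"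
    using finite_full_subgroups finite_subgroups_K subgroup_snd
    by (intro sum.group[symmetric]) (auto simp: full_subgroups_def abelian_subgroup_def)
  also have "\<dots> = (\<Sum>B | subgroup B K. of_nat (lambda_count A K \<phi> B) * h B)"
  proof (rule sum.cong[OF refl])
    fix B
    have "{M \<in> full_subgroups. snd ` M = B} = {H. abelian_subgroup H G \<and> snd ` H = B \<and>
        H \<inter> (carrier A \<times> {\<one>\<^bsub>K\<^esub>}) = fixed_subgroup A \<phi> B \<times> {\<one>\<^bsub>K\<^esub>}}"
      by (auto simp: full_subgroups_def)
    then show "(\<Sum>M | M \<in> full_subgroups \<and> snd ` M = B. h (snd ` M))
        = of_nat (lambda_count A K \<phi> B) * h B"
      by (simp add: lambda_count_def)
  qed
  finally show ?thesis
    by (simp add: h_def sum_distrib_left mult.assoc)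
qed

section \<open>Commuting tuples and coefficients as weighted sums\<close>

lemma card_commuting_tuples:
  "int (card (commuting_tuples n G)) = (\<Sum>t\<in>full_pairs. pair_weight t * int (card (restrict_pair t)) ^ n)"
proof -
  let ?T = "commuting_tuples n G"
  have fin: "finite ?T"
    unfolding commuting_tuples_def
    by (rule finite_subset[of _ "{..<n} \<rightarrow>\<^sub>E carrier G"]) (auto intro: finite_PiE simp: finite_G)
  have tuples_in: "{x \<in> ?T. x ` {..<n} \<subseteq> restrict_pair t} = {..<n} \<rightarrow>\<^sub>E restrict_pair t"
    if "t \<in> full_pairs" for t
  proof -
    have sub: "restrict_pair t \<subseteq> carrier G"
      and comm: "\<And>x y. x \<in> restrict_pair t \<Longrightarrow> y \<in> restrict_pair t \<Longrightarrow> x \<otimes>\<^bsub>G\<^esub> y = y \<otimes>\<^bsub>G\<^esub> x"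
      using abelian_restrict_pair[OF that] subgroup.subset
      by (auto simp: abelian_subgroup_iff[OF G.is_group])
    show ?thesis
    proof (intro equalityI subsetI)
      fix x assume "x \<in> {x \<in> ?T. x ` {..<n} \<subseteq> restrict_pair t}"
      then show "x \<in> {..<n} \<rightarrow>\<^sub>E restrict_pair t"
        by (auto simp: commuting_tuples_def PiE_iff)
    next
      fix x assume x: "x \<in> {..<n} \<rightarrow>\<^sub>E restrict_pair t"
      then have mem: "x i \<in> restrict_pair t" if "i < n" for i
        using that by (intro PiE_mem[of x "{..<n}" "\<lambda>_. restrict_pair t"]) simp_all
      have "x \<in> {..<n} \<rightarrow>\<^sub>E carrier G"
        using x PiE_mono[of "{..<n}" "\<lambda>_. restrict_pair t" "\<lambda>_. carrier G"] sub by blast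
      moreover have "x ` {..<n} \<subseteq> restrict_pair t"
        using mem by blast
      moreover have "\<forall>i<n. \<forall>j<n. x i \<otimes>\<^bsub>G\<^esub> x j = x j \<otimes>\<^bsub>G\<^esub> x i"
        by (intro allI impI comm mem)
      ultimately show "x \<in> {x \<in> ?T. x ` {..<n} \<subseteq> restrict_pair t}"
        by (simp add: commuting_tuples_def)
    qed
  qed
  \<comment> \<open>Each tuple is counted with the total weight 1 of the pairs covering the abelian
    subgroup that it generates; after exchanging the sums, a pair contributes all tuples with
    entries in its subgroup.\<close>
  have "int (card ?T) = (\<Sum>x\<in>?T. 1)"
    by simp
  also have "\<dots> = (\<Sum>x\<in>?T. \<Sum>t | t \<in> full_pairs \<and> x ` {..<n} \<subseteq> restrict_pair t. pair_weight t)"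
  proof (rule sum.cong[OF refl])
    fix x assume x: "x \<in> ?T"
    let ?X = "generate G (x ` {..<n})"
    have "abelian_subgroup ?X G"
      using x by (intro G.abelian_subgroup_generate) (auto simp: commuting_tuples_def)
    moreover have "x ` {..<n} \<subseteq> restrict_pair t \<longleftrightarrow> ?X \<subseteq> restrict_pair t" if "t \<in> full_pairs" for t
    proof
      show "?X \<subseteq> restrict_pair t" if "x ` {..<n} \<subseteq> restrict_pair t"
        using G.generate_subgroup_incl[OF that] abelian_restrict_pair[OF \<open>t \<in> full_pairs\<close>]
        by (simp add: abelian_subgroup_def)
      show "x ` {..<n} \<subseteq> restrict_pair t" if "?X \<subseteq> restrict_pair t"
        using that generate.incl[of _ "x ` {..<n}" G] by blast
    qed
    ultimately show "1 = (\<Sum>t | t \<in> full_pairs \<and> x ` {..<n} \<subseteq> restrict_pair t. pair_weight t)"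
      using sum_pair_weight[of ?X] by (simp cong: conj_cong)
  qed
  also have "\<dots> = (\<Sum>t\<in>full_pairs. \<Sum>x | x \<in> ?T \<and> x ` {..<n} \<subseteq> restrict_pair t. pair_weight t)"
    by (rule sum.swap_restrict[OF fin finite_full_pairs])
  also have "\<dots> = (\<Sum>t\<in>full_pairs. pair_weight t * int (card (restrict_pair t)) ^ n)"
    by (intro sum.cong) (auto simp: tuples_in card_PiE)
  finally show ?thesis .
qed

text \<open>Division by the power of |G| turns subgroup orders into reciprocal indices.\<close>

lemma commuting_prob_eq:
  "commuting_prob n G =
    (\<Sum>t\<in>full_pairs. of_int (pair_weight t) * (1 / real (subgroup_index G (restrict_pair t)) ^ n))"
proof -
  have "real (card (restrict_pair t)) ^ n / real (order G) ^ n
      = 1 / real (subgroup_index G (restrict_pair t)) ^ n" if "t \<in> full_pairs" for t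
  proof -
    have R: "subgroup (restrict_pair t) G"
      using abelian_restrict_pair[OF that] by (simp add: abelian_subgroup_def)
    have "order G = subgroup_index G (restrict_pair t) * card (restrict_pair t)"
      using G.lagrange[OF R] by (simp add: subgroup_index_def)
    moreover have "card (restrict_pair t) > 0"
      by (rule subgroup.finite_imp_card_positive[OF R finite_G])
    ultimately show ?thesis
      by (simp add: power_mult_distrib)
  qed
  moreover have "real (card (commuting_tuples n G))
      = (\<Sum>t\<in>full_pairs. of_int (pair_weight t) * real (card (restrict_pair t)) ^ n)"
    using arg_cong[OF card_commuting_tuples[of n], of real_of_int] by simp
  ultimately show ?thesis
    by (simp add: commuting_prob_def sum_divide_distrib times_divide_eq_right[symmetric]
        del: times_divide_eq_right)
qed

text \<open>Supplies the nonzero m in the geometric expansion of 1/(m(m - z)).\<close>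

lemma pair_index_pos:
  assumes "subgroup B K" "subgroup D K"
  shows "pair_index A K \<phi> B D > 0"
proof -
  have "subgroup (fixed_subgroup A \<phi> B) A"
    using subgroup.subset[OF assms(1)] by (rule subgroup_fixed)
  then have "card (rcosets\<^bsub>A\<^esub> fixed_subgroup A \<phi> B) * card (fixed_subgroup A \<phi> B) > 0"
    using A.lagrange A.order_gt_0_iff_finite finite_A by metis
  moreover have "card (rcosets\<^bsub>K\<^esub> D) * card D > 0"
    using K.lagrange[OF assms(2)] K.order_gt_0_iff_finite finite_K by metis
  ultimately show ?thesis
    by (simp add: pair_index_def subgroup_index_def)
qed

lemma abelian_moebius_eq:
  assumes "\<not> comm_group G" "abelian_subgroup H G"
  shows "- abelian_moebius G H (carrier G) = (\<Sum>t | t \<in> full_pairs \<and> restrict_pair t = H. pair_weight t)"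
  unfolding abelian_moebius_def
proof (rule moebius_top_eq_weight_sum)
  fix X assume "X \<in> {H. abelian_subgroup H G}"
  then have "X \<subseteq> carrier G" "comm_group (G\<lparr>carrier := X\<rparr>)"
    using subgroup.subset by (auto simp: abelian_subgroup_def)
  \<comment> \<open>Here non-commutativity enters: G itself is not abelian, so it is a new top
    element.\<close>
  then show "X \<subset> carrier G"
    using assms(1) by (auto simp: psubset_eq)
qed (use assms finite_G finite_full_pairs abelian_restrict_pair sum_pair_weight in auto)

lemma c_coeff_eq:
  assumes "\<not> comm_group G"
  shows "c_coeff m G =
    (\<Sum>t\<in>full_pairs. pair_weight t * (if subgroup_index G (restrict_pair t) = m then 1 else 0))"
proof -
  let ?H = "{H. abelian_subgroup H G \<and> subgroup_index G H = m}"
  let ?T = "{t \<in> full_pairs. subgroup_index G (restrict_pair t) = m}"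
  have finH: "finite ?H"
    using subgroup.subset finite_G
    by (intro finite_subset[of ?H "Pow (carrier G)"]) (force simp: abelian_subgroup_def)+
  have "c_coeff m G = (\<Sum>H\<in>?H. - abelian_moebius G H (carrier G))"
    by (simp add: c_coeff_def sum_negf)
  also have "\<dots> = (\<Sum>H\<in>?H. \<Sum>t | t \<in> ?T \<and> restrict_pair t = H. pair_weight t)"
  proof (rule sum.cong[OF refl])
    fix H assume "H \<in> ?H"
    moreover from this have "{t \<in> ?T. restrict_pair t = H} = {t \<in> full_pairs. restrict_pair t = H}"
      by auto
    ultimately show "- abelian_moebius G H (carrier G)
        = (\<Sum>t | t \<in> ?T \<and> restrict_pair t = H. pair_weight t)"
      using abelian_moebius_eq[OF assms] by auto
  qed
  \<comment> \<open>The inner sums run over the fibres of \<open>restrict_pair\<close> on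
    \<open>?T\<close>.\<close>
  also have "\<dots> = sum pair_weight ?T"
    using finite_full_pairs finH abelian_restrict_pair by (intro sum.group) auto
  also have "\<dots> = (\<Sum>t\<in>full_pairs. pair_weight t * (if subgroup_index G (restrict_pair t) = m then 1 else 0))"
    using finite_full_pairs by (intro sum.mono_neutral_cong_left) auto
  finally show ?thesis .
qed

end

theorem corollary4p19:
  fixes A :: "('a, 'c) monoid_scheme" and K :: "('b, 'd) monoid_scheme"
    and \<phi> :: "'b \<Rightarrow> 'a \<Rightarrow> 'a" and G :: "('a \<times> 'b) monoid"
  assumes "comm_group A" and "finite (carrier A)"
    and "comm_group K" and "finite (carrier K)"
    and "\<phi> \<in> hom K (AutoGroup A)"
    and "G = semidirect_product A K \<phi>"
    and "\<not> comm_group G"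
  shows "(\<forall>m\<ge>2. c_coeff m G =
            (\<Sum>(B, D) \<in> {(B, D). subgroup B K \<and> subgroup D K \<and> D \<subseteq> B \<and> m = pair_index A K \<phi> B D}.
               int (lambda_count A K \<phi> B) * subgroup_moebius K D B))
       \<and> commuting_series G =
            (\<Sum>B \<in> {B. subgroup B K}. \<Sum>D \<in> {D. subgroup D K \<and> D \<subseteq> B}.
               fps_const (of_int (int (lambda_count A K \<phi> B) * subgroup_moebius K D B)) /
               (fps_const (of_nat (pair_index A K \<phi> B D)) *
                 (fps_const (of_nat (pair_index A K \<phi> B D)) - fps_X)))"
proof -
  interpret abelian_semidirect A K \<phi>
    using assms(1-5) by (simp add: abelian_semidirect_def abelian_semidirect_axioms_def)
  let ?c = "\<lambda>B D. int (lambda_count A K \<phi> B) * subgroup_moebius K D B"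
  let ?m = "pair_index A K \<phi>"
  let ?S = "Sigma {B. subgroup B K} (\<lambda>B. {D. subgroup D K \<and> D \<subseteq> B})"
  have finS: "finite ?S"
    using finite_subgroups_K by auto
  have "c_coeff m G = (\<Sum>(B, D) \<in> {(B, D). subgroup B K \<and> subgroup D K \<and> D \<subseteq> B \<and> m = ?m B D}. ?c B D)"
    for m
  proof -
    have "c_coeff m G = (\<Sum>t\<in>full_pairs. pair_weight t *
        (if subgroup_index (semidirect_product A K \<phi>) (restrict_pair t) = m then 1 else 0))"
      using c_coeff_eq assms(6,7) by simp
    also have "\<dots> = (\<Sum>B \<in> {B. subgroup B K}. \<Sum>D \<in> {D. subgroup D K \<and> D \<subseteq> B}.
        ?c B D * (if ?m B D = m then 1 else 0))"
      \<comment> \<open>The indicator of index m selects the pairs that contribute to the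
        coefficient.\<close>
      using sum_full_pairs[of "\<lambda>k. if k = m then 1 else (0 :: int)"] by simp
    also have "\<dots> = (\<Sum>(B, D)\<in>?S. ?c B D * (if ?m B D = m then 1 else 0))"
      using finite_subgroups_K by (intro sum.Sigma) auto
    also have "\<dots> = (\<Sum>(B, D) \<in> {(B, D). subgroup B K \<and> subgroup D K \<and> D \<subseteq> B \<and> m = ?m B D}. ?c B D)"
      using finS by (intro sum.mono_neutral_cong_right) (auto split: if_splits)
    finally show ?thesis .
  qed
  moreover have "commuting_series G =
      (\<Sum>B \<in> {B. subgroup B K}. \<Sum>D \<in> {D. subgroup D K \<and> D \<subseteq> B}.
        fps_const (of_int (?c B D)) / (fps_const (of_nat (?m B D)) * (fps_const (of_nat (?m B D)) - fps_X)))"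
    (is "_ = ?R")
  proof (rule fps_ext)
    fix n
    have "fps_nth (commuting_series G) n = (\<Sum>B \<in> {B. subgroup B K}. \<Sum>D \<in> {D. subgroup D K \<and> D \<subseteq> B}.
        of_int (?c B D) * (1 / real (?m B D) ^ (n + 2)))"
      \<comment> \<open>The coefficient of z^n is the probability for r = n + 2, so g is k \<mapsto>
        1/k^(n + 2), the shape of the geometric coefficients.\<close>
      unfolding assms(6) commuting_series_def fps_nth_Abs_fps commuting_prob_eq
      by (rule sum_full_pairs)
    also have "\<dots> = (\<Sum>B \<in> {B. subgroup B K}. \<Sum>D \<in> {D. subgroup D K \<and> D \<subseteq> B}.
        fps_nth (fps_const (of_int (?c B D)) /
          (fps_const (of_nat (?m B D)) * (fps_const (of_nat (?m B D)) - fps_X))) n)"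
      using pair_index_pos by (intro sum.cong refl, subst fps_geometric_nth) force+
    finally show "fps_nth (commuting_series G) n = fps_nth ?R n"
      by (simp add: fps_sum_nth)
  qed
  ultimately show ?thesis
    by blast
qed

end
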